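(* Let $A,B\in M_{n,m}$. Let $\lambda\ge 0$ be such that $A_1=A+\lambda J$ and $B_1=B+\lambda J$ are nonnegative, let $\mu>0$ be such that all column sums of $A_2=\frac1\mu A_1$ and of $B_2=\frac1\mu B_1$ do not exceed $1$, define $v\in\mathbb{R}^m$ by $v^t=\frac1n(e^t-e^tB_2)$, and put $A'=A_2+ev^t$, $B'=B_2+ev^t$. Then $A\preceq^s B$ if and only if $A'\preceq^s B'$. In addition, $B'$ is column stochastic. Moreover, if the majorization $A\preceq^s B$ holds, then $e^tA'=e^t$ and both $A'$ and $B'$ are column stochastic.
   Context: $M_{n,m}$ is the space of real $n\times m$ matrices; $J$ is the $n\times m$ matrix of all ones; $e$ denotes the all-ones column vector of the appropriate size (in $e^tA$ and $ev^t$, $e\in\mathbb{R}^n$; in $e^t-e^tB_2$ and on the right of $e^tA'=e^t$, the lone $e^t$ is the all-ones row vector of length $m$). A matrix is nonnegative if all its entries are nonnegative, and column stochastic if it is nonnegative with every column sum equal to $1$. $A\preceq^s B$ (strong majorization) means $A=DB$ for some doubly stochastic $n\times n$ matrix $D$ (nonnegative, all row and column sums equal to $1$). *)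

theory Defs
  imports "HOL-Analysis.Analysis"
begin

text \<open>An element of \<open>M\<^bsub>n,m\<^esub>\<close> is a term of type \<^typ>\<open>real ^ 'm ^ 'n\<close>
  (rows indexed by \<open>'n\<close>, columns by \<open>'m\<close>), with \<open>n = CARD('n)\<close> and \<open>m = CARD('m)\<close>.\<close>

definition ones_vec :: "real ^ 'k" where
  "ones_vec = (\<chi> i. 1)"

definition ones_mat :: "real ^ 'm ^ 'n" where
  "ones_mat = (\<chi> i j. 1)"

text \<open>The rank-one matrix \<open>u v\<^sup>t\<close>.\<close>

definition outer_prod :: "real ^ 'n \<Rightarrow> real ^ 'm \<Rightarrow> real ^ 'm ^ 'n" where
  "outer_prod u v = (\<chi> i j. u $ i * v $ j)"

definition nonneg_mat :: "real ^ 'm ^ 'n \<Rightarrow> bool" where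
  "nonneg_mat A \<longleftrightarrow> (\<forall>i j. 0 \<le> A $ i $ j)"

definition col_sum :: "real ^ 'm ^ 'n \<Rightarrow> 'm \<Rightarrow> real" where
  "col_sum A j = (\<Sum>i\<in>UNIV. A $ i $ j)"

definition row_sum :: "real ^ 'm ^ 'n \<Rightarrow> 'n \<Rightarrow> real" where
  "row_sum A i = (\<Sum>j\<in>UNIV. A $ i $ j)"

definition column_stochastic :: "real ^ 'm ^ 'n \<Rightarrow> bool" where
  "column_stochastic A \<longleftrightarrow> nonneg_mat A \<and> (\<forall>j. col_sum A j = 1)"

definition doubly_stochastic :: "real ^ 'n ^ 'n \<Rightarrow> bool" where
  "doubly_stochastic D \<longleftrightarrow>
     nonneg_mat D \<and> (\<forall>i. row_sum D i = 1) \<and> (\<forall>j. col_sum D j = 1)"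

definition strongly_majorized :: "real ^ 'm ^ 'n \<Rightarrow> real ^ 'm ^ 'n \<Rightarrow> bool"
    (infix "\<preceq>\<^sup>s" 50) where
  "A \<preceq>\<^sup>s B \<longleftrightarrow> (\<exists>D. doubly_stochastic D \<and> A = D ** B)"

end

theory Submission
  imports Defs
begin

text \<open>
  The passage from \<^term>\<open>A\<close> to \<open>A'\<close> is an affine map
  \<open>X \<mapsto> c X + e w\<^sup>t\<close> with \<open>c = 1 / \<mu>\<close> and \<open>w = (l / \<mu>) e + v\<close>, and it is the
  \<^emph>\<open>same\<close> map that sends \<^term>\<open>B\<close> to \<open>B'\<close>: the shift \<open>l J\<close> is itself of the form \<open>e u\<^sup>t\<close>,
  and \<open>v\<close> is computed from \<open>B\<^sub>2\<close> but added to both matrices. A matrix \<open>D\<close> whose rows sum to 1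
  satisfies \<open>D e = e\<close>, so left multiplication by \<open>D\<close> fixes every \<open>e w\<^sup>t\<close> and hence commutes with
  this map. As \<open>c \<noteq> 0\<close> the map is injective, so one and the same \<open>D\<close> witnesses both
  majorizations (\<open>strongly_majorized_affine_iff\<close>).

  The vector \<open>v\<close> spreads the defect of each column sum of \<open>B\<^sub>2\<close> evenly over the \<open>n\<close> entries of
  that column; \<open>B\<^sub>2\<close> and the defects are nonnegative, so \<open>B'\<close> is column stochastic. Left multiplication by a
  doubly stochastic matrix preserves column stochasticity, because the columns of \<open>D\<close> sum to 1
  (\<open>column_stochastic_if_strongly_majorized\<close>), and this carries the property from \<open>B'\<close> to \<open>A'\<close>.
\<close>

text \<open>Row sums equal to 1 mean \<open>D e = e\<close>, hence \<open>D (e w\<^sup>t) = e w\<^sup>t\<close>.\<close>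

lemma matrix_mult_affine_ones:
  fixes D :: "real ^ 'n ^ 'n" and B :: "real ^ 'm ^ 'n"
  assumes "\<And>i. row_sum D i = 1"
  shows "D ** (c *\<^sub>R B + outer_prod ones_vec w) = c *\<^sub>R (D ** B) + outer_prod ones_vec w"
proof -
  have "(D ** (c *\<^sub>R B + outer_prod ones_vec w)) $ i $ j
      = (c *\<^sub>R (D ** B) + outer_prod ones_vec w) $ i $ j" for i j
  proof -
    have "(D ** (c *\<^sub>R B + outer_prod ones_vec w)) $ i $ j
        = c * (\<Sum>k\<in>UNIV. D $ i $ k * B $ k $ j) + row_sum D i * w $ j"
      by (simp add: matrix_matrix_mult_def outer_prod_def ones_vec_def row_sum_def
          sum.distrib sum_distrib_left sum_distrib_right algebra_simps)
    then show ?thesis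
      by (simp add: assms matrix_matrix_mult_def outer_prod_def ones_vec_def)
  qed
  then show ?thesis
    by (simp add: vec_eq_iff)
qed

text \<open>The equivalence holds for each witness \<open>D\<close> separately: after pulling \<open>D\<close> through the affine
  map, the term \<open>e w\<^sup>t\<close> and the factor \<open>c\<close> cancel from \<open>c A + e w\<^sup>t = c (D B) + e w\<^sup>t\<close>.\<close>

lemma strongly_majorized_affine_iff:
  fixes A B :: "real ^ 'm ^ 'n"
  assumes "c \<noteq> 0"
  shows "c *\<^sub>R A + outer_prod ones_vec w \<preceq>\<^sup>s c *\<^sub>R B + outer_prod ones_vec w \<longleftrightarrow> A \<preceq>\<^sup>s B"
proof -
  have "c *\<^sub>R A + outer_prod ones_vec w = D ** (c *\<^sub>R B + outer_prod ones_vec w) \<longleftrightarrow> A = D ** B"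
    if "doubly_stochastic D" for D
    using that assms by (simp add: matrix_mult_affine_ones doubly_stochastic_def)
  then show ?thesis
    unfolding strongly_majorized_def by blast
qed

lemma col_sum_matrix_mult:
  fixes D :: "real ^ 'n ^ 'k" and B :: "real ^ 'm ^ 'n"
  shows "col_sum (D ** B) j = (\<Sum>k\<in>UNIV. col_sum D k * B $ k $ j)"
proof -
  have "col_sum (D ** B) j = (\<Sum>i\<in>UNIV. \<Sum>k\<in>UNIV. D $ i $ k * B $ k $ j)"
    by (simp add: col_sum_def matrix_matrix_mult_def)
  also have "\<dots> = (\<Sum>k\<in>UNIV. \<Sum>i\<in>UNIV. D $ i $ k * B $ k $ j)"
    by (rule sum.swap)
  finally show ?thesis
    by (simp add: col_sum_def sum_distrib_right)
qed

text \<open>Column sums equal to 1 mean \<open>e\<^sup>t D = e\<^sup>t\<close>, hence \<open>e\<^sup>t (D B) = e\<^sup>t B\<close>.\<close>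

lemma column_stochastic_if_strongly_majorized:
  assumes "A \<preceq>\<^sup>s B" "column_stochastic B"
  shows "column_stochastic A"
proof -
  obtain D where D: "doubly_stochastic D" and A: "A = D ** B"
    using assms(1) by (auto simp: strongly_majorized_def)
  have "nonneg_mat A"
    using D assms(2) unfolding A
    by (auto simp: nonneg_mat_def doubly_stochastic_def column_stochastic_def
        matrix_matrix_mult_def intro!: sum_nonneg)
  moreover have "col_sum A j = 1" for j
  proof -
    have "col_sum A j = col_sum B j"
      using D by (simp add: A col_sum_matrix_mult doubly_stochastic_def col_sum_def[of B])
    then show ?thesis
      using assms(2) by (simp add: column_stochastic_def)
  qed
  ultimately show ?thesis
    by (simp add: column_stochastic_def)
qed

lemma ones_vec_mult_nth: "(ones_vec v* A) $ j = col_sum A j"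
  by (simp add: ones_vec_def vector_matrix_mult_def col_sum_def)

text \<open>Each of the \<open>n\<close> entries of column \<open>j\<close> receives the same share of \<open>1 - col_sum X j\<close>, so the
  column is completed to sum 1 without any entry decreasing.\<close>

lemma column_stochastic_add_column_defect:
  fixes X :: "real ^ 'm ^ 'n"
  assumes "nonneg_mat X" "\<And>j. col_sum X j \<le> 1"
  shows "column_stochastic
    (X + outer_prod ones_vec ((1 / real CARD('n)) *\<^sub>R (ones_vec - ones_vec v* X)))"
    (is "column_stochastic ?Y")
proof -
  have entry: "?Y $ i $ j = X $ i $ j + (1 - col_sum X j) / real CARD('n)" for i j
    by (simp add: outer_prod_def ones_vec_mult_nth) (simp add: ones_vec_def)
  have "nonneg_mat ?Y"
    using assms unfolding nonneg_mat_def entry by simp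
  moreover have "col_sum ?Y j = 1" for j
    unfolding col_sum_def[of ?Y] entry
    by (simp add: sum.distrib col_sum_def)
  ultimately show ?thesis
    by (simp add: column_stochastic_def)
qed

theorem corollary3p5:
  fixes A B A1 B1 A2 B2 A' B' :: "real ^ 'm ^ 'n"
    and l \<mu> :: real
    and v :: "real ^ 'm"
  assumes "l \<ge> 0"
    and "A1 = A + l *\<^sub>R ones_mat"
    and "B1 = B + l *\<^sub>R ones_mat"
    and "nonneg_mat A1"
    and "nonneg_mat B1"
    and "\<mu> > 0"
    and "A2 = (1 / \<mu>) *\<^sub>R A1"
    and "B2 = (1 / \<mu>) *\<^sub>R B1"
    and "\<forall>j. col_sum A2 j \<le> 1"
    and "\<forall>j. col_sum B2 j \<le> 1"
    and "v = (1 / real CARD('n)) *\<^sub>R (ones_vec - ones_vec v* B2)"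
    and "A' = A2 + outer_prod ones_vec v"
    and "B' = B2 + outer_prod ones_vec v"
  shows "(A \<preceq>\<^sup>s B \<longleftrightarrow> A' \<preceq>\<^sup>s B') \<and>
    column_stochastic B' \<and>
    (A \<preceq>\<^sup>s B \<longrightarrow>
       ones_vec v* A' = ones_vec \<and> column_stochastic A' \<and> column_stochastic B')"
proof -
  define w where "w = (l / \<mu>) *\<^sub>R ones_vec + v"
  have affine: "(1 / \<mu>) *\<^sub>R (X + l *\<^sub>R ones_mat) + outer_prod ones_vec v
      = (1 / \<mu>) *\<^sub>R X + outer_prod ones_vec w" for X :: "real ^ 'm ^ 'n"
    by (simp add: vec_eq_iff w_def ones_mat_def ones_vec_def outer_prod_def algebra_simps)
  have A': "A' = (1 / \<mu>) *\<^sub>R A + outer_prod ones_vec w"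
    and B': "B' = (1 / \<mu>) *\<^sub>R B + outer_prod ones_vec w"
    using assms affine by simp_all
  have iff: "A \<preceq>\<^sup>s B \<longleftrightarrow> A' \<preceq>\<^sup>s B'"
    unfolding A' B' using \<open>\<mu> > 0\<close> by (simp add: strongly_majorized_affine_iff)
  have "nonneg_mat B2"
    using \<open>nonneg_mat B1\<close> \<open>\<mu> > 0\<close> \<open>B2 = (1 / \<mu>) *\<^sub>R B1\<close> by (simp add: nonneg_mat_def)
  then have stoch_B': "column_stochastic B'"
    using column_stochastic_add_column_defect[of B2]
      \<open>\<forall>j. col_sum B2 j \<le> 1\<close> \<open>B' = B2 + outer_prod ones_vec v\<close>
      \<open>v = (1 / real CARD('n)) *\<^sub>R (ones_vec - ones_vec v* B2)\<close>
    by simp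
  have "ones_vec v* A' = ones_vec \<and> column_stochastic A'" if "A \<preceq>\<^sup>s B"
  proof -
    have "column_stochastic A'"
      using that iff stoch_B' column_stochastic_if_strongly_majorized by blast
    then show ?thesis
      by (simp add: vec_eq_iff ones_vec_mult_nth column_stochastic_def) (simp add: ones_vec_def)
  qed
  with iff stoch_B' show ?thesis
    by blast
qed

end
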